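(* Let $Y$ be a real topological vector space, $F\subset Y$, $D$ a nonempty closed proper subset of $Y$ and $k\in0^+D\setminus\{0\}$. Then $$\operatorname{Eff}(F,D)=\{y^0\in F\mid\forall y\in(F\cap\operatorname{dom}\varphi_{y^0-D,k})\setminus\{y^0\}:\ \varphi_{y^0-D,k}(y)>0\}$$ $$=\{y^0\in F\mid\forall y\in(F\cap\operatorname{dom}\varphi_{y^0-D,k})\setminus\{y^0\}:\ \varphi_{-D,k}(y-y^0)>0\}.$$ If $0\in D$, then $\varphi_{y^0-D,k}(y^0)=\varphi_{-D,k}(y^0-y^0)\le0$ for each $y^0\in Y$. If $D+\mathbb{R}_>k\subseteq\operatorname{int}D$ and $0\in\operatorname{bd}D$, then $\varphi_{y^0-D,k}(y^0)=\varphi_{-D,k}(y^0-y^0)=0$ for each $y^0\in Y$, and $$\operatorname{Eff}(F,D)=\{y^0\in F\mid\forall y\in(F\cap\operatorname{dom}\varphi_{y^0-D,k})\setminus\{y^0\}:\ \varphi_{y^0-D,k}(y^0)<\varphi_{y^0-D,k}(y)\},$$ $$\operatorname{Eff}(F,D)=\{y^0\in F\mid\forall y\in(F\cap\operatorname{dom}\varphi_{y^0-D,k})\setminus\{y^0\}:\ \varphi_{-D,k}(y^0-y^0)<\varphi_{-D,k}(y-y^0)\}.$$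
   Context: $\mathbb{R}_+=\{x\in\mathbb{R}\mid x\ge0\}$, $\mathbb{R}_>=\{x\in\mathbb{R}\mid x>0\}$; $0^+D:=\{u\in Y\mid\forall d\in D\ \forall t\in\mathbb{R}_+: d+tu\in D\}$ is the recession cone. $\operatorname{Eff}(F,D):=\{y^0\in F\mid F\cap(y^0-D)\subseteq\{y^0\}\}$. For $a\in Y$, define $\varphi_{a-D,k}(y):=\inf\{t\in\mathbb{R}\mid y\in a-D+tk\}$ for $y\in Y$, where $\inf\emptyset:=\nu$ is a symbol outside the extended reals marking infeasibility, and $\operatorname{dom}\varphi_{a-D,k}:=\{y\in Y\mid\varphi_{a-D,k}(y)\in\mathbb{R}\cup\{-\infty\}\}=a-D+\mathbb{R}k$. $\varphi_{-D,k}$ stands for $\varphi_{0-D,k}$. *)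

theory Defs
  imports "HOL-Analysis.Analysis"
begin

(* No separation axiom is included. *)
class real_tvs = real_vector + topological_ab_group_add +
  assumes tendsto_scaleR_Pair: "LIM p (nhds r \<times>\<^sub>F nhds x). fst p *\<^sub>R snd p :> nhds (r *\<^sub>R x)"

instance real_normed_vector \<subseteq> real_tvs
proof
  fix r :: real and x :: "'a::real_normed_vector"
  have "((\<lambda>p. p) \<longlongrightarrow> (r, x)) (nhds (r, x))"
    by (rule filterlim_ident)
  from tendsto_scaleR[OF tendsto_fst[OF this] tendsto_snd[OF this]]
  show "LIM p (nhds r \<times>\<^sub>F nhds x). fst p *\<^sub>R snd p :> nhds (r *\<^sub>R x)"
    by (simp add: nhds_prod)
qed

lemma tendsto_scaleR_tvs:
  fixes g :: "'b \<Rightarrow> 'a::real_tvs"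
  assumes "(f \<longlongrightarrow> r) F" "(g \<longlongrightarrow> x) F"
  shows "((\<lambda>z. f z *\<^sub>R g z) \<longlongrightarrow> r *\<^sub>R x) F"
  using filterlim_compose[OF tendsto_scaleR_Pair, of "\<lambda>z. (f z, g z)" r x F] assms
  by (simp add: nhds_prod[symmetric] tendsto_Pair)

definition recession_cone :: "'a::real_vector set \<Rightarrow> 'a set" where
  "recession_cone D = {u. \<forall>d\<in>D. \<forall>t::real. t \<ge> 0 \<longrightarrow> d + t *\<^sub>R u \<in> D}"

definition pt_minus :: "'a::ab_group_add \<Rightarrow> 'a set \<Rightarrow> 'a set" where
  "pt_minus a D = {a - d | d. d \<in> D}"

definition Eff :: "'a::ab_group_add set \<Rightarrow> 'a set \<Rightarrow> 'a set" where
  "Eff F D = {y0 \<in> F. F \<inter> pt_minus y0 D \<subseteq> {y0}}"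

(* Values lie in the extended reals together with one extra symbol for the infimum of the
   empty set: Some r is the extended real r, and None is the extra symbol. In particular
   None is not Some \<infinity>. *)
definition phi :: "'a::real_vector set \<Rightarrow> 'a \<Rightarrow> 'a \<Rightarrow> ereal option" where
  "phi A k y =
     (let T = {t::real. \<exists>a\<in>A. y = a + t *\<^sub>R k}
      in if T = {} then None else Some (Inf (ereal ` T)))"

definition dom_phi :: "'a::real_vector set \<Rightarrow> 'a \<Rightarrow> 'a set" where
  "dom_phi A k = {y. phi A k y \<in> Some ` (range ereal \<union> {-\<infinity>})}"

lemma dom_phi_eq: "dom_phi A k = {a + t *\<^sub>R k | a t. a \<in> A}"
proof (rule set_eqI)
  fix y
  define T where "T = {t::real. \<exists>a\<in>A. y = a + t *\<^sub>R k}"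
  have "Inf (ereal ` T) \<in> range ereal \<union> {-\<infinity>}" if "T \<noteq> {}"
  proof -
    from that obtain t where "t \<in> T" by blast
    then have "Inf (ereal ` T) \<le> ereal t" by (simp add: INF_lower)
    then show ?thesis by (cases "Inf (ereal ` T)") auto
  qed
  moreover have "phi A k y = (if T = {} then None else Some (Inf (ereal ` T)))"
    unfolding phi_def T_def Let_def ..
  ultimately have "y \<in> dom_phi A k \<longleftrightarrow> T \<noteq> {}"
    by (cases "T = {}") (simp_all only: dom_phi_def mem_Collect_eq if_True if_False, auto)
  then show "y \<in> dom_phi A k \<longleftrightarrow> y \<in> {a + t *\<^sub>R k | a t. a \<in> A}"
    by (auto simp: T_def)
qed

(* The order of the extended reals; the extra symbol is not comparable with anything. *)
definition nu_less :: "ereal option \<Rightarrow> ereal option \<Rightarrow> bool"  (infix "\<prec>" 50) where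
  "u \<prec> v \<longleftrightarrow> (\<exists>r s. u = Some r \<and> v = Some s \<and> r < s)"

definition nu_le :: "ereal option \<Rightarrow> ereal option \<Rightarrow> bool"  (infix "\<preceq>" 50) where
  "u \<preceq> v \<longleftrightarrow> (\<exists>r s. u = Some r \<and> v = Some s \<and> r \<le> s)"

end

theory Submission
  imports Defs
begin

text \<open>
  The value of \<^term>\<open>phi (pt_minus a D) k\<close> at \<open>y\<close> is the infimum of the real numbers \<open>t\<close> with
  \<open>(a - y) + t *\<^sub>R k \<in> D\<close>, so it depends on \<open>a\<close> and \<open>y\<close> only through \<open>a - y\<close>; this is why the
  criteria with base set \<open>y0 - D\<close> and with base set \<open>- D\<close> coincide.

  Since \<open>k\<close> is a recession direction of \<open>D\<close>, the admissible \<open>t\<close> form an up-set of the real line,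
  and since \<open>D\<close> is closed and \<open>t \<mapsto> (a - y) + t *\<^sub>R k\<close> is continuous, this up-set is closed.
  Hence the infimum, if finite, is attained, and the sublevel sets of the functional are the
  translates \<open>a - D + r *\<^sub>R k\<close> (lemma \<open>phi_le_iff\<close>). At level \<open>0\<close> this says that a feasible
  \<open>y\<close> has a positive value exactly if \<open>y \<notin> a - D\<close>. The condition
  \<open>F \<inter> (y0 - D) \<subseteq> {y0}\<close> that defines efficiency thus is positivity on the feasible
  points of \<open>F\<close> other than \<open>y0\<close>; infeasible points never lie in \<open>y0 - D\<close>.

  If moreover \<open>D\<close> is moved into its interior by positive multiples of \<open>k\<close> and \<open>0\<close> is a boundary
  point, then no \<open>t *\<^sub>R k\<close> with \<open>t < 0\<close> belongs to \<open>D\<close>, for otherwise \<open>0\<close> would be interior.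
  The value at \<open>y0\<close> is therefore \<open>0\<close>, and the bound \<open>0\<close> in the criteria can be replaced
  by that value.
\<close>

definition admissible_steps :: "'a::real_vector set \<Rightarrow> 'a \<Rightarrow> 'a \<Rightarrow> real set" where
  "admissible_steps D k z = {t. z + t *\<^sub>R k \<in> D}"

lemma phi_pt_minus:
  "phi (pt_minus a D) k y =
     (if admissible_steps D k (a - y) = {} then None
      else Some (Inf (ereal ` admissible_steps D k (a - y))))"
proof -
  have "(\<exists>b\<in>pt_minus a D. y = b + t *\<^sub>R k) \<longleftrightarrow> a - y + t *\<^sub>R k \<in> D" for t
  proof
    assume "\<exists>b\<in>pt_minus a D. y = b + t *\<^sub>R k"
    then obtain d where "d \<in> D" "y = a - d + t *\<^sub>R k"
      by (auto simp: pt_minus_def)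
    then show "a - y + t *\<^sub>R k \<in> D" by simp
  next
    assume "a - y + t *\<^sub>R k \<in> D"
    then show "\<exists>b\<in>pt_minus a D. y = b + t *\<^sub>R k"
      unfolding pt_minus_def
      by (intro bexI[of _ "a - (a - y + t *\<^sub>R k)"]) (simp, blast)
  qed
  then show ?thesis
    by (simp add: phi_def admissible_steps_def Let_def)
qed

lemma phi_pt_minus_translate:
  "phi (pt_minus a D) k y = phi (pt_minus 0 D) k (y - a)"
  by (simp add: phi_pt_minus)

lemma mem_dom_phi_pt_minus:
  "y \<in> dom_phi (pt_minus a D) k \<longleftrightarrow> admissible_steps D k (a - y) \<noteq> {}"
proof
  assume "y \<in> dom_phi (pt_minus a D) k"
  then show "admissible_steps D k (a - y) \<noteq> {}"
    by (auto simp: dom_phi_def phi_pt_minus)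
next
  assume "admissible_steps D k (a - y) \<noteq> {}"
  then obtain t where "a - y + t *\<^sub>R k \<in> D"
    by (auto simp: admissible_steps_def)
  then have "a - (a - y + t *\<^sub>R k) \<in> pt_minus a D"
    unfolding pt_minus_def by blast
  moreover have "y = a - (a - y + t *\<^sub>R k) + t *\<^sub>R k" by simp
  ultimately show "y \<in> dom_phi (pt_minus a D) k"
    unfolding dom_phi_eq by blast
qed

lemma mem_pt_minus_iff: "y \<in> pt_minus a D \<longleftrightarrow> a - y \<in> D"
proof
  assume "a - y \<in> D"
  then have "a - (a - y) \<in> pt_minus a D"
    unfolding pt_minus_def by blast
  then show "y \<in> pt_minus a D" by simp
qed (auto simp: pt_minus_def)

lemma closed_admissible_steps:
  fixes D :: "'a::real_tvs set"
  assumes "closed D"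
  shows "closed (admissible_steps D k z)"
proof -
  have "((\<lambda>t. z + t *\<^sub>R k) \<longlongrightarrow> z + s *\<^sub>R k) (at s)" for s :: real
    by (intro tendsto_add tendsto_const tendsto_scaleR_tvs tendsto_ident_at)
  then have "continuous_on UNIV (\<lambda>t::real. z + t *\<^sub>R k)"
    by (simp add: continuous_on_def)
  from closed_vimage[OF assms this] show ?thesis
    by (simp add: admissible_steps_def vimage_def)
qed

lemma admissible_steps_upward:
  assumes "k \<in> recession_cone D" "s \<in> admissible_steps D k z" "s \<le> t"
  shows "t \<in> admissible_steps D k z"
proof -
  have "(z + s *\<^sub>R k) + (t - s) *\<^sub>R k \<in> D"
    using assms by (simp add: recession_cone_def admissible_steps_def)
  then show ?thesis
    by (simp add: admissible_steps_def algebra_simps)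
qed

text \<open>
  Every level above the infimum is admissible because the admissible steps form an up-set;
  closedness then makes the level \<open>r\<close> itself admissible.
\<close>

lemma Inf_admissible_steps_le_iff:
  fixes D :: "'a::real_tvs set"
  assumes "closed D" and "k \<in> recession_cone D"
  shows "Inf (ereal ` admissible_steps D k z) \<le> ereal r \<longleftrightarrow> r \<in> admissible_steps D k z"
proof
  let ?T = "admissible_steps D k z"
  assume le: "Inf (ereal ` ?T) \<le> ereal r"
  have "r + e \<in> ?T" if "e > 0" for e
  proof -
    have "Inf (ereal ` ?T) < ereal (r + e)"
      using le that by (simp add: le_less_trans)
    then obtain s where "s \<in> ?T" "s < r + e"
      by (auto simp: Inf_less_iff)
    then show ?thesis
      using admissible_steps_upward[OF assms(2)] by simp
  qed
  then have "\<exists>t\<in>?T. dist t r < e" if "e > 0" for e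
    using that by (intro bexI[of _ "r + e / 2"]) (auto simp: dist_real_def)
  then show "r \<in> ?T"
    using closed_admissible_steps[OF assms(1)] closed_approachable by blast
qed (simp add: INF_lower)

lemma phi_le_iff:
  fixes D :: "'a::real_tvs set"
  assumes "closed D" and "k \<in> recession_cone D"
  shows "phi (pt_minus a D) k y \<preceq> Some (ereal r) \<longleftrightarrow> a - y + r *\<^sub>R k \<in> D"
  using Inf_admissible_steps_le_iff[OF assms, of "a - y" r]
  by (auto simp: phi_pt_minus nu_le_def admissible_steps_def)

lemma phi_pos_iff:
  fixes D :: "'a::real_tvs set"
  assumes "closed D" and "k \<in> recession_cone D" and "y \<in> dom_phi (pt_minus a D) k"
  shows "Some 0 \<prec> phi (pt_minus a D) k y \<longleftrightarrow> y \<notin> pt_minus a D"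
proof -
  have ne: "admissible_steps D k (a - y) \<noteq> {}"
    using assms(3) by (simp add: mem_dom_phi_pt_minus)
  then have "Some 0 \<prec> phi (pt_minus a D) k y \<longleftrightarrow> \<not> phi (pt_minus a D) k y \<preceq> Some (ereal 0)"
    by (auto simp: phi_pt_minus nu_less_def nu_le_def zero_ereal_def)
  then show ?thesis
    by (simp add: phi_le_iff[OF assms(1,2)] mem_pt_minus_iff)
qed

lemma pt_minus_subset_dom_phi: "pt_minus a D \<subseteq> dom_phi (pt_minus a D) k"
proof
  fix y assume "y \<in> pt_minus a D"
  then have "0 \<in> admissible_steps D k (a - y)"
    by (simp add: mem_pt_minus_iff admissible_steps_def)
  then show "y \<in> dom_phi (pt_minus a D) k"
    by (auto simp: mem_dom_phi_pt_minus)
qed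

lemma Eff_eq_phi_pos:
  fixes F D :: "'a::real_tvs set"
  assumes "closed D" and "k \<in> recession_cone D"
  shows "Eff F D = {y0 \<in> F. \<forall>y \<in> (F \<inter> dom_phi (pt_minus y0 D) k) - {y0}.
           Some 0 \<prec> phi (pt_minus y0 D) k y}"
  using phi_pos_iff[OF assms] pt_minus_subset_dom_phi[of _ D k]
  unfolding Eff_def by blast

lemma phi_at_vertex_nonpos:
  fixes D :: "'a::real_tvs set"
  assumes "closed D" and "k \<in> recession_cone D" and "0 \<in> D"
  shows "phi (pt_minus a D) k a \<preceq> Some 0"
  using phi_le_iff[OF assms(1,2), of a a 0] assms(3) by (simp add: zero_ereal_def)

lemma phi_at_vertex_eq_0:
  fixes D :: "'a::real_tvs set"
  assumes "closed D" and "k \<in> recession_cone D"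
    and int: "{d + t *\<^sub>R k | d t. d \<in> D \<and> t > 0} \<subseteq> interior D" and "0 \<in> frontier D"
  shows "phi (pt_minus a D) k a = Some 0"
proof -
  have 0: "0 \<in> D" "0 \<notin> interior D"
    using assms(1,4) by (auto simp: frontier_def)
  have "t \<ge> 0" if "t \<in> admissible_steps D k 0" for t
  proof (rule ccontr)
    assume "\<not> t \<ge> 0"
    \<comment> \<open>Going back from \<open>t *\<^sub>R k\<close> by the positive step \<open>- t\<close> would make \<open>0\<close> an interior point.\<close>
    have "t *\<^sub>R k + (- t) *\<^sub>R k \<in> interior D"
    proof (rule subsetD[OF int], intro CollectI exI conjI)
      show "t *\<^sub>R k \<in> D"
        using that by (simp add: admissible_steps_def)
      show "0 < - t"
        using \<open>\<not> t \<ge> 0\<close> by simp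
    qed (rule refl)
    with 0 show False by simp
  qed
  moreover have "0 \<in> admissible_steps D k 0"
    using 0 by (simp add: admissible_steps_def)
  ultimately have "Inf (ereal ` admissible_steps D k 0) = 0"
    by (intro antisym Inf_lower Inf_greatest) (auto simp: zero_ereal_def)
  with \<open>0 \<in> admissible_steps D k 0\<close> show ?thesis
    by (auto simp: phi_pt_minus)
qed

theorem theorem6:
  fixes F D :: "'a::real_tvs set" and k :: 'a
  assumes "D \<noteq> {}" and "closed D" and "D \<noteq> UNIV"
    and "k \<in> recession_cone D - {0}"
  shows
    "Eff F D =
       {y0 \<in> F. \<forall>y \<in> (F \<inter> dom_phi (pt_minus y0 D) k) - {y0}.
          Some 0 \<prec> phi (pt_minus y0 D) k y} \<and>
     Eff F D =
       {y0 \<in> F. \<forall>y \<in> (F \<inter> dom_phi (pt_minus y0 D) k) - {y0}.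
          Some 0 \<prec> phi (pt_minus 0 D) k (y - y0)} \<and>
     (0 \<in> D \<longrightarrow>
       (\<forall>y0. phi (pt_minus y0 D) k y0 = phi (pt_minus 0 D) k (y0 - y0) \<and>
             phi (pt_minus 0 D) k (y0 - y0) \<preceq> Some 0)) \<and>
     ({d + t *\<^sub>R k | d t. d \<in> D \<and> t > 0} \<subseteq> interior D \<and> 0 \<in> frontier D \<longrightarrow>
       (\<forall>y0. phi (pt_minus y0 D) k y0 = phi (pt_minus 0 D) k (y0 - y0) \<and>
             phi (pt_minus 0 D) k (y0 - y0) = Some 0) \<and>
       Eff F D =
         {y0 \<in> F. \<forall>y \<in> (F \<inter> dom_phi (pt_minus y0 D) k) - {y0}.
            phi (pt_minus y0 D) k y0 \<prec> phi (pt_minus y0 D) k y} \<and>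
       Eff F D =
         {y0 \<in> F. \<forall>y \<in> (F \<inter> dom_phi (pt_minus y0 D) k) - {y0}.
            phi (pt_minus 0 D) k (y0 - y0) \<prec> phi (pt_minus 0 D) k (y - y0)})"
proof -
  have k: "k \<in> recession_cone D" using assms(4) by simp
  note Eff = Eff_eq_phi_pos[OF \<open>closed D\<close> k]
  have tr: "phi (pt_minus 0 D) k (y - y0) = phi (pt_minus y0 D) k y" for y y0
    by (rule phi_pt_minus_translate[symmetric])
  have nonpos: "phi (pt_minus y0 D) k y0 \<preceq> Some 0" if "0 \<in> D" for y0
    using phi_at_vertex_nonpos[OF \<open>closed D\<close> k that] .
  have zero: "phi (pt_minus y0 D) k y0 = Some 0"
    if "{d + t *\<^sub>R k | d t. d \<in> D \<and> t > 0} \<subseteq> interior D \<and> 0 \<in> frontier D" for y0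
    using that by (intro phi_at_vertex_eq_0[OF \<open>closed D\<close> k]) auto
  show ?thesis
    unfolding tr
    by (intro conjI impI allI) (simp_all only: Eff nonpos zero)
qed

end
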